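(* For each integer $n\geq 2$ there exists a finite sequence $\xi=(\xi_1,\xi_2,\ldots,\xi_n)$ of random variables taking values in $\{-1,0,1\}$ such that $\xi$ is two-color exchangeable but $\xi$ is not exchangeable.
   Context: A finite sequence of random variables $(\xi_1,\ldots,\xi_n)$ (defined on a common probability space) taking values in a Polish space $S$ is called exchangeable if $(\xi_1,\ldots,\xi_n)$ and $(\xi_{\pi(1)},\ldots,\xi_{\pi(n)})$ have the same distribution for every permutation $\pi$ of $[n]=\{1,\ldots,n\}$. A finite sequence of random variables $(\xi_1,\ldots,\xi_n)$ taking values in a Polish space $(S,\mathcal{S})$ is called two-color exchangeable if for every measurable function $f:S\to\{0,1\}$ the binary sequence $(f(\xi_1),\ldots,f(\xi_n))$ is exchangeable. Here $S=\{-1,0,1\}$ is equipped with the discrete topology, so every function $f:S\to\{0,1\}$ is measurable. *)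

theory Defs
  imports "HOL-Probability.Probability" "HOL-Combinatorics.Permutations"
begin

text \<open>
  The state space of the random variables is given as a measurable space \<open>S\<close>; for a Polish
  space this is its Borel space. A sequence \<open>\<xi>\<close> of length \<open>n\<close> is indexed by \<open>{1..n}\<close>, and its
  values at other indices are irrelevant. Measurability of the \<open>\<xi> i\<close> is not part of the predicates
  (so that it does not get negated along with them) and has to be required separately.
\<close>

definition joint_law :: "'a measure \<Rightarrow> 's measure \<Rightarrow> nat \<Rightarrow> (nat \<Rightarrow> 'a \<Rightarrow> 's) \<Rightarrow> (nat \<Rightarrow> 's) measure"
  where "joint_law M S n \<xi> = distr M (Pi\<^sub>M {1..n} (\<lambda>_. S)) (\<lambda>\<omega>. \<lambda>i\<in>{1..n}. \<xi> i \<omega>)"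

definition exchangeable :: "'a measure \<Rightarrow> 's measure \<Rightarrow> nat \<Rightarrow> (nat \<Rightarrow> 'a \<Rightarrow> 's) \<Rightarrow> bool"
  where "exchangeable M S n \<xi> \<longleftrightarrow>
    (\<forall>\<pi>. \<pi> permutes {1..n} \<longrightarrow> joint_law M S n (\<lambda>i. \<xi> (\<pi> i)) = joint_law M S n \<xi>)"

definition two_color_exchangeable :: "'a measure \<Rightarrow> 's measure \<Rightarrow> nat \<Rightarrow> (nat \<Rightarrow> 'a \<Rightarrow> 's) \<Rightarrow> bool"
  where "two_color_exchangeable M S n \<xi> \<longleftrightarrow>
    (\<forall>f \<in> S \<rightarrow>\<^sub>M count_space {0, 1::nat}.
      exchangeable M (count_space {0, 1::nat}) n (\<lambda>i \<omega>. f (\<xi> i \<omega>)))"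

text \<open>The Borel sets of a finite discrete space are all its subsets, so its Borel space is
  \<^const>\<open>count_space\<close>.\<close>

lemma sets_count_space_discrete_topology:
  "sets (count_space A) = sigma_sets A {U. openin (discrete_topology A) U}"
proof -
  have "{U. openin (discrete_topology A) U} = Pow A" by auto
  then show ?thesis using sets.sigma_sets_eq[of "count_space A"] by simp
qed

end

theory Submission
  imports Defs
begin

text \<open>
  Place \<open>-1, 0, 1\<close> on a circle and start from \<open>n\<close> independent uniform letters. Whenever the second
  letter is the cyclic predecessor of the first, interchange these two letters. Afterwards the pair
  \<open>(\<xi> 1, \<xi> 2)\<close> takes the value \<open>(a, a + 1)\<close> with probability \<open>2/9\<close> and the value \<open>(a + 1, a)\<close>
  with probability \<open>0\<close>, so the sequence is not exchangeable.

  Two colors do not see this orientation of the circle. A function on a three-point set with two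
  values is constant off some point \<open>a\<close>, so only the positions of the letter \<open>a\<close> matter. There are
  two pairs containing \<open>a\<close> once that get interchanged, namely \<open>(a, a - 1)\<close> and \<open>(a + 1, a)\<close>. They
  are equally likely and their colorings are reversals of each other, so interchanging the letters inside each
  pair has the same effect on colors as exchanging the two pairs with each other
  (\<open>color_reorient\<close>). The latter is a bijection of the uniform sample space, hence the colored
  sequence has the same law as an independent uniform sequence with the same coloring
  (\<open>joint_law_bij\<close>), which is exchangeable.
\<close>

section \<open>Joint laws over a uniform sample space\<close>

lemma joint_law_cong:
  assumes "\<And>i \<omega>. i \<in> {1..n} \<Longrightarrow> \<omega> \<in> space M \<Longrightarrow> X i \<omega> = Y i \<omega>"
  shows "joint_law M S n X = joint_law M S n Y"
  unfolding joint_law_def by (intro distr_cong) (auto simp: assms)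

lemma measurable_tuple_uniform_count_measure:
  assumes "\<And>i \<omega>. i \<in> {1..n} \<Longrightarrow> \<omega> \<in> \<Omega> \<Longrightarrow> X i \<omega> \<in> space S"
  shows "(\<lambda>\<omega>. \<lambda>i\<in>{1..n}. X i \<omega>) \<in> uniform_count_measure \<Omega> \<rightarrow>\<^sub>M Pi\<^sub>M {1..n} (\<lambda>_. S)"
  using assms
  by (intro measurableI)
    (auto simp: space_uniform_count_measure sets_uniform_count_measure space_PiM)

lemma distr_uniform_count_measure_bij:
  assumes "finite \<Omega>" and "bij_betw \<phi> \<Omega> \<Omega>"
  shows "distr (uniform_count_measure \<Omega>) (uniform_count_measure \<Omega>) \<phi> = uniform_count_measure \<Omega>"
    (is "distr ?U _ _ = _")
proof (rule measure_eqI)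
  fix A assume "A \<in> sets (distr ?U ?U \<phi>)"
  then have A: "A \<subseteq> \<Omega>" by (simp add: sets_uniform_count_measure)
  have into: "\<phi> ` \<Omega> = \<Omega>" and inj: "inj_on \<phi> \<Omega>"
    using assms(2) by (auto simp: bij_betw_def)
  have meas: "\<phi> \<in> ?U \<rightarrow>\<^sub>M ?U"
    using into by (intro measurableI)
      (auto simp: space_uniform_count_measure sets_uniform_count_measure)
  have "\<phi> ` (\<phi> -` A \<inter> \<Omega>) = A \<inter> \<phi> ` \<Omega>" by blast
  then have "\<phi> ` (\<phi> -` A \<inter> \<Omega>) = A" using A into by blast
  then have "card A = card (\<phi> -` A \<inter> \<Omega>)"
    using card_image[OF inj_on_subset[OF inj, of "\<phi> -` A \<inter> \<Omega>"]] by simp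
  then show "emeasure (distr ?U ?U \<phi>) A = emeasure ?U A"
    using A assms(1) meas
    by (simp add: emeasure_distr sets_uniform_count_measure space_uniform_count_measure
        emeasure_uniform_count_measure)
qed simp

lemma joint_law_bij:
  assumes "finite \<Omega>" and bij: "bij_betw \<phi> \<Omega> \<Omega>"
    and X: "\<And>i \<omega>. i \<in> {1..n} \<Longrightarrow> \<omega> \<in> \<Omega> \<Longrightarrow> X i \<omega> \<in> space S"
  shows "joint_law (uniform_count_measure \<Omega>) S n (\<lambda>i \<omega>. X i (\<phi> \<omega>))
    = joint_law (uniform_count_measure \<Omega>) S n X"
proof -
  let ?U = "uniform_count_measure \<Omega>"
  let ?T = "\<lambda>\<omega>. \<lambda>i\<in>{1..n}. X i \<omega>"
  have "\<phi> \<in> ?U \<rightarrow>\<^sub>M ?U"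
    using bij_betwE[OF bij] by (intro measurableI)
      (auto simp: space_uniform_count_measure sets_uniform_count_measure)
  then have "distr (distr ?U ?U \<phi>) (Pi\<^sub>M {1..n} (\<lambda>_. S)) ?T
      = distr ?U (Pi\<^sub>M {1..n} (\<lambda>_. S)) (?T \<circ> \<phi>)"
    by (intro distr_distr measurable_tuple_uniform_count_measure X)
  then show ?thesis
    by (simp add: joint_law_def comp_def
        distr_uniform_count_measure_bij[OF assms(1,2)])
qed

section \<open>The oriented sequence\<close>

abbreviation letters :: "int set" where "letters \<equiv> {-1, 0, 1}"

definition words :: "nat \<Rightarrow> (nat \<Rightarrow> int) set"
  where "words n = {1..n} \<rightarrow>\<^sub>E letters"

definition cyc :: "int \<Rightarrow> int"
  where "cyc x = (if x = 1 then -1 else x + 1)"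

definition orient :: "(nat \<Rightarrow> int) \<Rightarrow> (nat \<Rightarrow> int)"
  where "orient \<omega> = (if \<omega> 1 = cyc (\<omega> 2) then \<omega> (1 := \<omega> 2, 2 := \<omega> 1) else \<omega>)"

text \<open>On the first two letters, this is the transposition of the pairs \<open>(a, a - 1)\<close> and
  \<open>(a + 1, a)\<close>; the predecessor of \<open>a\<close> is written as its second successor.\<close>

definition reorient :: "int \<Rightarrow> (nat \<Rightarrow> int) \<Rightarrow> (nat \<Rightarrow> int)"
  where "reorient a \<omega> =
    (if \<omega> 1 = a \<and> \<omega> 2 = cyc (cyc a) then \<omega> (1 := cyc a, 2 := a)
     else if \<omega> 1 = cyc a \<and> \<omega> 2 = a then \<omega> (1 := a, 2 := cyc (cyc a))
     else \<omega>)"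

lemma cyc_in_letters: "x \<in> letters \<Longrightarrow> cyc x \<in> letters"
  by (auto simp: cyc_def)

lemma finite_words: "finite (words n)"
  by (auto simp: words_def intro: finite_PiE)

lemma words_update:
  assumes "w \<in> words n" "i \<in> {1..n}" "x \<in> letters"
  shows "w(i := x) \<in> words n"
  using assms by (auto simp: words_def PiE_iff extensional_def)

lemma words_letters: "\<omega> \<in> words n \<Longrightarrow> i \<in> {1..n} \<Longrightarrow> \<omega> i \<in> letters"
  unfolding words_def by (rule PiE_mem)

lemma words_first_two:
  assumes "2 \<le> n" "\<omega> \<in> words n"
  shows "\<omega> 1 \<in> letters" "\<omega> 2 \<in> letters"
  by (rule words_letters[OF assms(2)]; use assms(1) in simp)+

lemma words_nonempty: "words n \<noteq> {}"
  by (auto simp: words_def PiE_eq_empty_iff)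

lemma orient_in_words:
  assumes "2 \<le> n" "\<omega> \<in> words n"
  shows "orient \<omega> \<in> words n"
proof -
  have "1 \<in> {1..n}" "2 \<in> {1..n}" using assms(1) by auto
  then show ?thesis
    unfolding orient_def
    using words_update words_first_two[OF assms] assms(2) by presburger
qed

lemma reorient_in_words:
  assumes "2 \<le> n" "a \<in> letters" "\<omega> \<in> words n"
  shows "reorient a \<omega> \<in> words n"
proof -
  have "1 \<in> {1..n}" "2 \<in> {1..n}" using assms(1) by auto
  then show ?thesis
    unfolding reorient_def
    using words_update cyc_in_letters assms(2,3) by presburger
qed

lemma reorient_reorient:
  assumes "a \<in> letters"
  shows "reorient a (reorient a \<omega>) = \<omega>"
  using assms by (auto simp: reorient_def cyc_def fun_eq_iff)

lemma bij_betw_reorient: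
  assumes "2 \<le> n" "a \<in> letters"
  shows "bij_betw (reorient a) (words n) (words n)"
  by (rule bij_betw_byWitness[where f' = "reorient a"])
    (use reorient_reorient[OF assms(2)] reorient_in_words[OF assms] in blast)+

lemma bij_betw_permute_words:
  assumes "\<pi> permutes {1..n}"
  shows "bij_betw (\<lambda>\<omega>. \<omega> \<circ> \<pi>) (words n) (words n)"
proof (rule bij_betw_byWitness[where f' = "\<lambda>\<omega>. \<omega> \<circ> inv \<pi>"])
  have closed: "\<omega> \<circ> \<rho> \<in> words n" if "\<rho> permutes {1..n}" "\<omega> \<in> words n" for \<rho> \<omega>
    using that permutes_in_image[OF that(1)] permutes_not_in[OF that(1)]
    unfolding words_def PiE_iff extensional_def by (simp del: insert_iff)
  show "(\<lambda>\<omega>. \<omega> \<circ> \<pi>) ` words n \<subseteq> words n" using closed[OF assms] by blast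
  show "(\<lambda>\<omega>. \<omega> \<circ> inv \<pi>) ` words n \<subseteq> words n"
    using closed[OF permutes_inv[OF assms]] by blast
qed (simp_all add: comp_assoc permutes_inv_o[OF assms])

section \<open>Two colors\<close>

text \<open>This is the pigeonhole principle, and the place where the number of colors enters: with
  three colors a coloring can separate all letters.\<close>

lemma two_coloring_constant_off_point:
  fixes f :: "int \<Rightarrow> nat"
  assumes "\<And>x. x \<in> letters \<Longrightarrow> f x \<in> {0, 1}"
  obtains a c where "a \<in> letters" "\<And>x. x \<in> letters \<Longrightarrow> x \<noteq> a \<Longrightarrow> f x = c"
proof -
  have "f (-1) \<in> {0, 1}" "f 0 \<in> {0, 1}" "f 1 \<in> {0, 1}"
    using assms by blast+
  then consider "f (-1) = f 0" | "f 0 = f 1" | "f (-1) = f 1" by force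
  then show ?thesis
  proof cases
    case 1 then show ?thesis using that[of 1 "f 0"] by auto
  next
    case 2 then show ?thesis using that[of "-1" "f 0"] by auto
  next
    case 3 then show ?thesis using that[of 0 "f 1"] by auto
  qed
qed

lemma color_reorient:
  assumes "2 \<le> n" and a: "a \<in> letters" and \<omega>: "\<omega> \<in> words n"
    and const: "\<And>x. x \<in> letters \<Longrightarrow> x \<noteq> a \<Longrightarrow> f x = c"
  shows "f (orient \<omega> i) = f (reorient a \<omega> i)"
proof -
  note w = words_first_two[OF \<open>2 \<le> n\<close> \<omega>]
  have f: "-1 \<noteq> a \<Longrightarrow> f (-1) = c" "0 \<noteq> a \<Longrightarrow> f 0 = c" "1 \<noteq> a \<Longrightarrow> f 1 = c"
    using const by auto
  consider "i = 1" | "i = 2" | "i \<noteq> 1" "i \<noteq> 2" by blast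
  then show ?thesis
  proof cases
    case 1
    then show ?thesis using w a f
      by (elim insertE emptyE) (simp_all add: orient_def reorient_def cyc_def)
  next
    case 2
    then show ?thesis using w a f
      by (elim insertE emptyE) (simp_all add: orient_def reorient_def cyc_def)
  next
    case 3
    then show ?thesis by (simp add: orient_def reorient_def)
  qed
qed

lemma two_color_exchangeable_orient:
  assumes n: "2 \<le> n"
  shows "two_color_exchangeable (uniform_count_measure (words n)) (count_space letters) n
    (\<lambda>i \<omega>. orient \<omega> i)"
  unfolding two_color_exchangeable_def exchangeable_def
proof (intro ballI allI impI)
  fix f :: "int \<Rightarrow> nat" and \<pi>
  assume "f \<in> count_space letters \<rightarrow>\<^sub>M count_space {0, 1}" and \<pi>: "\<pi> permutes {1..n}"
  then have f: "f x \<in> {0, 1}" if "x \<in> letters" for x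
    using that measurable_space[of f "count_space letters" "count_space {0, 1}" x] by simp
  obtain a c where a: "a \<in> letters" and const: "\<And>x. x \<in> letters \<Longrightarrow> x \<noteq> a \<Longrightarrow> f x = c"
    using two_coloring_constant_off_point[of f] f by metis
  let ?law = "joint_law (uniform_count_measure (words n)) (count_space {0, 1::nat}) n"
  have range: "f (\<omega> (\<rho> i)) \<in> space (count_space {0, 1})"
    if "\<rho> permutes {1..n}" "i \<in> {1..n}" "\<omega> \<in> words n" for \<rho> i \<omega>
  proof -
    have "\<rho> i \<in> {1..n}" using permutes_in_image[OF that(1)] that(2) by blast
    then show ?thesis using f[OF words_letters[OF that(3)]] by simp
  qed
  have oriented: "?law (\<lambda>i \<omega>. f (orient \<omega> (\<rho> i))) = ?law (\<lambda>i \<omega>. f (\<omega> (\<rho> i)))"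
    if \<rho>: "\<rho> permutes {1..n}" for \<rho>
  proof -
    have "?law (\<lambda>i \<omega>. f (orient \<omega> (\<rho> i))) = ?law (\<lambda>i \<omega>. f (reorient a \<omega> (\<rho> i)))"
    proof (rule joint_law_cong)
      fix i \<omega> assume "\<omega> \<in> space (uniform_count_measure (words n))"
      then have "\<omega> \<in> words n" by (simp add: space_uniform_count_measure)
      then show "f (orient \<omega> (\<rho> i)) = f (reorient a \<omega> (\<rho> i))"
        by (rule color_reorient[where f = f and c = c, OF n a _ const])
    qed
    also have "\<dots> = ?law (\<lambda>i \<omega>. f (\<omega> (\<rho> i)))"
      by (rule joint_law_bij[where X = "\<lambda>i \<omega>. f (\<omega> (\<rho> i))",
            OF finite_words bij_betw_reorient[OF n a]])
        (rule range[OF \<rho>])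
    finally show ?thesis .
  qed
  have "?law (\<lambda>i \<omega>. f (orient \<omega> (\<pi> i))) = ?law (\<lambda>i \<omega>. f ((\<omega> \<circ> \<pi>) i))"
    using oriented[OF \<pi>] by simp
  also have "\<dots> = ?law (\<lambda>i \<omega>. f (\<omega> i))"
    by (rule joint_law_bij[where X = "\<lambda>i \<omega>. f (\<omega> i)",
          OF finite_words bij_betw_permute_words[OF \<pi>]])
      (use range[OF permutes_id] in simp)
  also have "\<dots> = ?law (\<lambda>i \<omega>. f (orient \<omega> i))"
    using oriented[OF permutes_id] by simp
  finally show "?law (\<lambda>i \<omega>. f (orient \<omega> (\<pi> i))) = ?law (\<lambda>i \<omega>. f (orient \<omega> i))" .
qed

section \<open>Failure of exchangeability\<close>

text \<open>Three letters are needed here: on a circle with two points the successor is also the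
  predecessor, and an interchange would produce the very pattern that it removes.\<close>

lemma orient_not_descending:
  assumes "2 \<le> n" "\<omega> \<in> words n"
  shows "orient \<omega> 1 \<noteq> cyc (orient \<omega> 2)"
  using words_first_two[OF assms] by (auto simp: orient_def cyc_def)

lemma not_exchangeable_orient:
  assumes n: "2 \<le> n"
  shows "\<not> exchangeable (uniform_count_measure (words n)) (count_space letters) n
    (\<lambda>i \<omega>. orient \<omega> i)"
proof
  assume exch: "exchangeable (uniform_count_measure (words n)) (count_space letters) n
    (\<lambda>i \<omega>. orient \<omega> i)"
  let ?U = "uniform_count_measure (words n)"
  let ?P = "Pi\<^sub>M {1..n} (\<lambda>_. count_space letters)"
  let ?t = "Transposition.transpose 1 2 :: nat \<Rightarrow> nat"
  \<comment> \<open>The word \<open>0, 1, 0, 0, \<dots>\<close> is left alone by \<open>orient\<close>, whereas \<open>1, 0, 0, 0, \<dots>\<close>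
    is not in its image.\<close>
  define y :: "nat \<Rightarrow> int" where "y = (\<lambda>i\<in>{1..n}. if i = 2 then 1 else 0)"
  have y: "y \<in> words n" by (auto simp: y_def words_def)
  have y12: "y 1 = 0" "y 2 = 1" using n by (auto simp: y_def)
  have "?P = count_space (words n)"
    unfolding words_def by (rule count_space_PiM_finite) auto
  then have sets_y: "{y} \<in> sets ?P" using y by simp
  have t: "?t permutes {1..n}" using n by (auto intro: permutes_swap_id)
  have law: "emeasure (joint_law ?U (count_space letters) n (\<lambda>i \<omega>. orient \<omega> (\<rho> i))) {y}
      = emeasure ?U {\<omega> \<in> words n. (\<lambda>i\<in>{1..n}. orient \<omega> (\<rho> i)) = y}"
    if \<rho>: "\<rho> permutes {1..n}" for \<rho>
  proof -
    have "orient \<omega> (\<rho> i) \<in> space (count_space letters)"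
      if "i \<in> {1..n}" "\<omega> \<in> words n" for i \<omega>
    proof -
      have "\<rho> i \<in> {1..n}" using permutes_in_image[OF \<rho>] that(1) by blast
      then show ?thesis
        using words_letters[OF orient_in_words[OF n that(2)]] by (simp only: space_count_space)
    qed
    then have "(\<lambda>\<omega>. \<lambda>i\<in>{1..n}. orient \<omega> (\<rho> i)) \<in> ?U \<rightarrow>\<^sub>M ?P"
      by (rule measurable_tuple_uniform_count_measure)
    then show ?thesis
      unfolding joint_law_def
      by (subst emeasure_distr[OF _ sets_y])
        (auto simp: space_uniform_count_measure intro!: arg_cong[where f = "emeasure ?U"])
  qed
  have "{\<omega> \<in> words n. (\<lambda>i\<in>{1..n}. orient \<omega> (?t i)) = y} = {}"
  proof -
    have "(\<lambda>i\<in>{1..n}. orient \<omega> (?t i)) \<noteq> y" if "\<omega> \<in> words n" for \<omega>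
    proof
      assume eq: "(\<lambda>i\<in>{1..n}. orient \<omega> (?t i)) = y"
      have "orient \<omega> 2 = 0" "orient \<omega> 1 = 1"
        using fun_cong[OF eq, of 1] fun_cong[OF eq, of 2] y12 n by auto
      then show False using orient_not_descending[OF n that] by (simp add: cyc_def)
    qed
    then show ?thesis by blast
  qed
  then have "emeasure (joint_law ?U (count_space letters) n (\<lambda>i \<omega>. orient \<omega> (?t i))) {y} = 0"
    using law[OF t] by (simp only: emeasure_empty)
  then have null: "emeasure ?U {\<omega> \<in> words n. (\<lambda>i\<in>{1..n}. orient \<omega> i) = y} = 0"
    using exch t law[OF permutes_id] by (simp add: exchangeable_def)
  have "orient y = y" using y12 by (simp add: orient_def cyc_def)
  then have "y \<in> {\<omega> \<in> words n. (\<lambda>i\<in>{1..n}. orient \<omega> i) = y}" (is "_ \<in> ?A")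
    using y by (auto simp: y_def)
  moreover have "finite ?A" using finite_words[of n] by simp
  ultimately have "card ?A > 0" by (auto simp: card_gt_0_iff)
  moreover have "card (words n) > 0"
    using finite_words words_nonempty by (simp add: card_gt_0_iff)
  moreover have "emeasure ?U ?A = ennreal (real (card ?A) / real (card (words n)))"
    by (rule emeasure_uniform_count_measure) (auto simp: finite_words)
  ultimately show False using null by simp
qed

theorem mainTheorem1:
  fixes n :: nat
  assumes "n \<ge> 2"
  shows "\<exists>(M :: (nat \<Rightarrow> int) measure) (\<xi> :: nat \<Rightarrow> (nat \<Rightarrow> int) \<Rightarrow> int).
    prob_space M \<and>
    (\<forall>i\<in>{1..n}. \<xi> i \<in> M \<rightarrow>\<^sub>M count_space {-1, 0, 1}) \<and>
    two_color_exchangeable M (count_space {-1, 0, 1}) n \<xi> \<and>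
    \<not> exchangeable M (count_space {-1, 0, 1}) n \<xi>"
proof (intro exI conjI ballI)
  show "prob_space (uniform_count_measure (words n))"
    using finite_words words_nonempty by (rule prob_space_uniform_count_measure)
  show "(\<lambda>\<omega>. orient \<omega> i) \<in> uniform_count_measure (words n) \<rightarrow>\<^sub>M count_space letters"
    if "i \<in> {1..n}" for i
    using that words_letters[OF orient_in_words[OF assms]]
    by (intro measurableI)
      (auto simp: space_uniform_count_measure sets_uniform_count_measure simp del: insert_iff)
  show "two_color_exchangeable (uniform_count_measure (words n)) (count_space letters) n
      (\<lambda>i \<omega>. orient \<omega> i)"
    using assms by (rule two_color_exchangeable_orient)
  show "\<not> exchangeable (uniform_count_measure (words n)) (count_space letters) n
      (\<lambda>i \<omega>. orient \<omega> i)"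
    using assms by (rule not_exchangeable_orient)
qed

end
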